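(* Cantor's theorem holds in every extensive digraph.
   Context: A digraph is $D=\langle V,E\rangle$ with $V$ a nonempty set and $E\subseteq V\times V$; $uEv$ means $\langle u,v\rangle\in E$. $N(u)=\{v\in V: vEu\}$; elements of $N(u)$ are the $D$-elements of $u$. ZF formulas are first-order formulas with variables $x_1,x_2,\dots$, built from atomic formulas $(x_i\in x_j)$, $(x_i=x_j)$ using $\neg,\to,\leftrightarrow,\wedge,\vee$ and quantifiers $\exists x_k,\forall x_k$. $D\models\chi$, for a sentence $\chi$, is usual satisfaction with universe $V$, with $\in$ interpreted as $E$ and $=$ as equality. $D$ is extensive if the axiom schema of specification holds in it: for every $n\in\mathbb{N}=\{1,2,\dots\}$, every $n+3$ mutually distinct variables $v_1,\dots,v_{n+3}$ in $\{x_1,x_2,\dots\}$ and every ZF formula $\psi$ with free occurrences only of (some of) the variables $v_1,\dots,v_{n+2}$, $$D\models(\forall v_1(\dots(\forall v_n(\forall v_{n+1}(\exists v_{n+3}(\forall v_{n+2}((v_{n+2}\in v_{n+3})\leftrightarrow((v_{n+2}\in v_{n+1})\wedge\psi))))))\dots)).$$ For vertices of $D$: $u$ is a $D$-subset of $v$ ($u\subset_D v$) if $N(u)\subseteq N(v)$; $u$ is the singleton $\{v\}_D$ if $u$ is the only vertex with $N(u)=\{v\}$; $u$ is the doubleton $\{v,w\}_D$ if $u$ is the only vertex with $N(u)=\{v,w\}$; $u$ is an ordered pair $\langle v,w\rangle_D$ if $u=\{\{v\}_D,\{v,w\}_D\}_D$ (i.e. there are vertices $s,t$ such that $s$ is the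 singleton $\{v\}_D$, $t$ is the doubleton $\{v,w\}_D$ and $u$ is the doubleton $\{s,t\}_D$). $u$ is a $D$-relation from $v$ to $P(v)$ if every $D$-element of $u$ is an ordered pair $\langle w,w'\rangle_D$ with $wEv$ and $w'\subset_D v$. $u$ is a $D$-function from $v$ to $P(v)$ if it is a $D$-relation from $v$ to $P(v)$ and for every $D$-element $w$ of $v$ there is exactly one ordered pair $\langle w,w'\rangle_D$ that is a $D$-element of $u$. $u$ is a $D$-surjection from $v$ to $P(v)$ if it is a $D$-function from $v$ to $P(v)$ and for every $w'\subset_D v$ there is at least one ordered pair $\langle w,w'\rangle_D$ that is a $D$-element of $u$. Cantor's theorem holds in $D$ ($D$ is Cantor) if for no vertex $u\in V$ there exists a vertex $v\in V$ that is a $D$-surjection from $u$ to $P(u)$. *)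

theory Defs
  imports Main
begin

definition digraph :: "'a set \<Rightarrow> ('a \<times> 'a) set \<Rightarrow> bool" where
  "digraph V E \<longleftrightarrow> V \<noteq> {} \<and> E \<subseteq> V \<times> V"

definition N :: "'a set \<Rightarrow> ('a \<times> 'a) set \<Rightarrow> 'a \<Rightarrow> 'a set" where
  "N V E u = {v \<in> V. (v, u) \<in> E}"


(* A variable is given by its index; the number i stands for x_(i+1), so that every natural
   number is a variable. *)

datatype zf =
    Mem nat nat
  | Eq nat nat
  | Neg zf
  | Imp zf zf
  | Iff zf zf
  | Conj zf zf
  | Disj zf zf
  | Ex nat zf
  | All nat zf

primrec free_vars :: "zf \<Rightarrow> nat set" where
  "free_vars (Mem i j) = {i, j}"
| "free_vars (Eq i j) = {i, j}"
| "free_vars (Neg \<phi>) = free_vars \<phi>"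
| "free_vars (Imp \<phi> \<psi>) = free_vars \<phi> \<union> free_vars \<psi>"
| "free_vars (Iff \<phi> \<psi>) = free_vars \<phi> \<union> free_vars \<psi>"
| "free_vars (Conj \<phi> \<psi>) = free_vars \<phi> \<union> free_vars \<psi>"
| "free_vars (Disj \<phi> \<psi>) = free_vars \<phi> \<union> free_vars \<psi>"
| "free_vars (Ex k \<phi>) = free_vars \<phi> - {k}"
| "free_vars (All k \<phi>) = free_vars \<phi> - {k}"

primrec sat :: "'a set \<Rightarrow> ('a \<times> 'a) set \<Rightarrow> (nat \<Rightarrow> 'a) \<Rightarrow> zf \<Rightarrow> bool" where
  "sat V E s (Mem i j) \<longleftrightarrow> (s i, s j) \<in> E"
| "sat V E s (Eq i j) \<longleftrightarrow> s i = s j"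
| "sat V E s (Neg \<phi>) \<longleftrightarrow> \<not> sat V E s \<phi>"
| "sat V E s (Imp \<phi> \<psi>) \<longleftrightarrow> (sat V E s \<phi> \<longrightarrow> sat V E s \<psi>)"
| "sat V E s (Iff \<phi> \<psi>) \<longleftrightarrow> (sat V E s \<phi> \<longleftrightarrow> sat V E s \<psi>)"
| "sat V E s (Conj \<phi> \<psi>) \<longleftrightarrow> sat V E s \<phi> \<and> sat V E s \<psi>"
| "sat V E s (Disj \<phi> \<psi>) \<longleftrightarrow> sat V E s \<phi> \<or> sat V E s \<psi>"
| "sat V E s (Ex k \<phi>) \<longleftrightarrow> (\<exists>a\<in>V. sat V E (s(k := a)) \<phi>)"
| "sat V E s (All k \<phi>) \<longleftrightarrow> (\<forall>a\<in>V. sat V E (s(k := a)) \<phi>)"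

(* For a sentence the truth value does not depend on the assignment. *)

definition models :: "'a set \<Rightarrow> ('a \<times> 'a) set \<Rightarrow> zf \<Rightarrow> bool" where
  "models V E \<chi> \<longleftrightarrow> (\<forall>s. range s \<subseteq> V \<longrightarrow> sat V E s \<chi>)"


(* The variables v 1, ..., v (n + 3) are those called v_1, ..., v_(n+3) in the schema; the values
   of v at other arguments are irrelevant. The foldr is the prefix of quantifiers over
   v_1, ..., v_n. *)

definition specification_instance :: "nat \<Rightarrow> (nat \<Rightarrow> nat) \<Rightarrow> zf \<Rightarrow> zf" where
  "specification_instance n v \<psi> =
     foldr (\<lambda>i. All (v i)) [1..<n + 1]
       (All (v (n + 1)) (Ex (v (n + 3)) (All (v (n + 2))
         (Iff (Mem (v (n + 2)) (v (n + 3)))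
              (Conj (Mem (v (n + 2)) (v (n + 1))) \<psi>)))))"

definition extensive :: "'a set \<Rightarrow> ('a \<times> 'a) set \<Rightarrow> bool" where
  "extensive V E \<longleftrightarrow>
     (\<forall>n v \<psi>. n \<ge> 1 \<longrightarrow> inj_on v {1..n + 3} \<longrightarrow> free_vars \<psi> \<subseteq> v ` {1..n + 2} \<longrightarrow>
        models V E (specification_instance n v \<psi>))"


definition D_subset :: "'a set \<Rightarrow> ('a \<times> 'a) set \<Rightarrow> 'a \<Rightarrow> 'a \<Rightarrow> bool" where
  "D_subset V E u v \<longleftrightarrow> N V E u \<subseteq> N V E v"

definition D_singleton :: "'a set \<Rightarrow> ('a \<times> 'a) set \<Rightarrow> 'a \<Rightarrow> 'a \<Rightarrow> bool" where
  "D_singleton V E u v \<longleftrightarrow>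
     u \<in> V \<and> N V E u = {v} \<and> (\<forall>u'\<in>V. N V E u' = {v} \<longrightarrow> u' = u)"

definition D_doubleton :: "'a set \<Rightarrow> ('a \<times> 'a) set \<Rightarrow> 'a \<Rightarrow> 'a \<Rightarrow> 'a \<Rightarrow> bool" where
  "D_doubleton V E u v w \<longleftrightarrow>
     u \<in> V \<and> N V E u = {v, w} \<and> (\<forall>u'\<in>V. N V E u' = {v, w} \<longrightarrow> u' = u)"

definition D_pair :: "'a set \<Rightarrow> ('a \<times> 'a) set \<Rightarrow> 'a \<Rightarrow> 'a \<Rightarrow> 'a \<Rightarrow> bool" where
  "D_pair V E u v w \<longleftrightarrow>
     (\<exists>s\<in>V. \<exists>t\<in>V. D_singleton V E s v \<and> D_doubleton V E t v w \<and> D_doubleton V E u s t)"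


(* In the next three definitions, u is the relation, function or surjection from v to P(v). *)

definition D_relation :: "'a set \<Rightarrow> ('a \<times> 'a) set \<Rightarrow> 'a \<Rightarrow> 'a \<Rightarrow> bool" where
  "D_relation V E u v \<longleftrightarrow>
     (\<forall>p \<in> N V E u. \<exists>w \<in> N V E v. \<exists>w'\<in>V. D_subset V E w' v \<and> D_pair V E p w w')"

definition D_function :: "'a set \<Rightarrow> ('a \<times> 'a) set \<Rightarrow> 'a \<Rightarrow> 'a \<Rightarrow> bool" where
  "D_function V E u v \<longleftrightarrow>
     D_relation V E u v \<and>
     (\<forall>w \<in> N V E v. \<exists>!p. p \<in> N V E u \<and> (\<exists>w'\<in>V. D_pair V E p w w'))"

definition D_surjection :: "'a set \<Rightarrow> ('a \<times> 'a) set \<Rightarrow> 'a \<Rightarrow> 'a \<Rightarrow> bool" where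
  "D_surjection V E u v \<longleftrightarrow>
     D_function V E u v \<and>
     (\<forall>w'\<in>V. D_subset V E w' v \<longrightarrow> (\<exists>p \<in> N V E u. \<exists>w\<in>V. D_pair V E p w w'))"

definition cantor :: "'a set \<Rightarrow> ('a \<times> 'a) set \<Rightarrow> bool" where
  "cantor V E \<longleftrightarrow> \<not> (\<exists>u\<in>V. \<exists>v\<in>V. D_surjection V E v u)"

end

theory Submission
  imports Defs
begin

text \<open>
  Suppose \<open>f\<close> is a surjection from \<open>u\<close> to \<open>P(u)\<close> in the sense of the digraph.
  Specification yields a vertex \<open>d\<close> whose elements are the \<open>w \<in> u\<close> such that \<open>w \<notin> w'\<close> for every
  pair \<open>\<langle>w, w'\<rangle> \<in> f\<close>. Surjectivity gives a pair \<open>\<langle>w, d\<rangle> \<in> f\<close>, and \<open>w \<in> d\<close> holds iff \<open>w \<notin> d\<close>.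
  Extensionality is not available, but the vertices named by the pairing notation are unique by
  definition, so that a pair still determines its components.
\<close>

text \<open>The bound variables are fixed numbers: 8 and 9 here, 6 and 7 in \<open>pair_fm\<close>,
  4 and 5 in \<open>diagonal_fm\<close>. Arguments below them escape capture, whence the bounds in
  \<open>sat_doubleton_fm\<close> and \<open>sat_pair_fm\<close>.\<close>

definition doubleton_fm :: "nat \<Rightarrow> nat \<Rightarrow> nat \<Rightarrow> zf" where
  "doubleton_fm u a b =
     Conj (All 8 (Iff (Mem 8 u) (Disj (Eq 8 a) (Eq 8 b))))
       (All 9 (Imp (All 8 (Iff (Mem 8 9) (Disj (Eq 8 a) (Eq 8 b)))) (Eq 9 u)))"

definition pair_fm :: "nat \<Rightarrow> nat \<Rightarrow> nat \<Rightarrow> zf" where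
  "pair_fm p w w' =
     Ex 6 (Ex 7 (Conj (doubleton_fm 6 w w) (Conj (doubleton_fm 7 w w') (doubleton_fm p 6 7))))"

\<comment> \<open>The variables 0 and 2 stand for the function and for the candidate element of the diagonal set.\<close>

definition diagonal_fm :: zf where
  "diagonal_fm = All 4 (All 5 (Imp (Conj (Mem 4 0) (pair_fm 4 2 5)) (Neg (Mem 2 5))))"

lemma free_vars_diagonal_fm: "free_vars diagonal_fm = {0, 2}"
  by (auto simp: diagonal_fm_def pair_fm_def doubleton_fm_def)

lemma N_eq_doubleton_iff:
  assumes "a \<in> V" "b \<in> V"
  shows "N V E u = {a, b} \<longleftrightarrow> (\<forall>z\<in>V. (z, u) \<in> E \<longleftrightarrow> z = a \<or> z = b)"
  using assms unfolding N_def by blast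

lemma sat_doubleton_fm:
  assumes "s u \<in> V" "s a \<in> V" "s b \<in> V" and "u < 8" "a < 8" "b < 8"
  shows "sat V E s (doubleton_fm u a b) \<longleftrightarrow> D_doubleton V E (s u) (s a) (s b)"
  using assms by (auto simp: doubleton_fm_def D_doubleton_def N_eq_doubleton_iff)

lemma D_singleton_iff_doubleton: "D_singleton V E u v \<longleftrightarrow> D_doubleton V E u v v"
  by (simp add: D_singleton_def D_doubleton_def)

lemma sat_pair_fm:
  assumes "s p \<in> V" "s w \<in> V" "s w' \<in> V" and "p < 6" "w < 6" "w' < 6"
  shows "sat V E s (pair_fm p w w') \<longleftrightarrow> D_pair V E (s p) (s w) (s w')"
  using assms
  by (simp add: pair_fm_def D_pair_def D_singleton_iff_doubleton sat_doubleton_fm)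

lemma sat_diagonal_fm:
  assumes "s 2 \<in> V"
  shows "sat V E s diagonal_fm \<longleftrightarrow>
    (\<forall>p\<in>V. \<forall>w'\<in>V. (p, s 0) \<in> E \<and> D_pair V E p (s 2) w' \<longrightarrow> (s 2, w') \<notin> E)"
  using assms by (simp add: diagonal_fm_def sat_pair_fm)

text \<open>Kuratowski's argument: \<open>p\<close> determines \<open>s\<close> and \<open>t\<close>
  up to order, and their element sets determine \<open>a\<close> and \<open>b\<close>. In the
  crossed case all components coincide.\<close>

lemma D_pair_inject:
  assumes "D_pair V E p a b" "D_pair V E p c d"
  shows "a = c \<and> b = d"
proof -
  obtain s t where st: "N V E s = {a}" "N V E t = {a, b}" "N V E p = {s, t}"
    using assms(1) unfolding D_pair_def D_singleton_def D_doubleton_def by blast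
  obtain s' t' where st': "N V E s' = {c}" "N V E t' = {c, d}" "N V E p = {s', t'}"
    using assms(2) unfolding D_pair_def D_singleton_def D_doubleton_def by blast
  have "s = s' \<and> t = t' \<or> s = t' \<and> t = s'"
    using st(3) st'(3) by (auto simp: doubleton_eq_iff)
  then show ?thesis
    using st st' by (auto simp: doubleton_eq_iff)
qed

lemma extensive_separation:
  assumes ext: "extensive V E" and "f \<in> V" "u \<in> V"
    and free: "free_vars \<psi> \<subseteq> {0, 1, 2}"
  obtains d s where "d \<in> V"
    "\<forall>x\<in>V. (x, d) \<in> E \<longleftrightarrow> (x, u) \<in> E \<and> sat V E (s(0 := f, 1 := u, 3 := d, 2 := x)) \<psi>"
proof -
  \<comment> \<open>The schema numbers its variables from 1; the shift makes them 0, ..., 3.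
    Truncated subtraction is harmless, as the argument 0 lies outside the range.\<close>
  let ?v = "\<lambda>i::nat. i - 1"
  have inj: "inj_on ?v {1..1 + 3}"
    by (auto simp: inj_on_def)
  have "{1..1 + 2} = {1, 2, 3::nat}"
    by auto
  then have "?v ` {1..1 + 2} = {0, 1, 2}"
    by simp
  then have "models V E (specification_instance 1 ?v \<psi>)"
    using ext inj free unfolding extensive_def by (metis order_refl)
  then have "sat V E (\<lambda>_. u) (specification_instance 1 ?v \<psi>)"
    using \<open>u \<in> V\<close> by (auto simp: models_def)
  then show thesis
    using that[of _ "\<lambda>_. u"] assms(2,3)
    by (fastforce simp: specification_instance_def upt_rec numeral_2_eq_2)
qed

theorem theorem6p2:
  fixes V :: "'a set" and E :: "('a \<times> 'a) set"
  assumes "digraph V E" and "extensive V E"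
  shows "cantor V E"
proof -
  have False if uf: "u \<in> V" "f \<in> V" and surj: "D_surjection V E f u" for u f
  proof -
    have fv: "free_vars diagonal_fm \<subseteq> {0, 1, 2}"
      by (simp add: free_vars_diagonal_fm)
    obtain d s where "d \<in> V" and
      "\<forall>x\<in>V. (x, d) \<in> E \<longleftrightarrow> (x, u) \<in> E \<and> sat V E (s(0 := f, 1 := u, 3 := d, 2 := x)) diagonal_fm"
      by (rule extensive_separation[OF assms(2) uf(2,1) fv])
    then have d: "(x, d) \<in> E \<longleftrightarrow> (x, u) \<in> E \<and>
        (\<forall>p\<in>V. \<forall>w'\<in>V. (p, f) \<in> E \<and> D_pair V E p x w' \<longrightarrow> (x, w') \<notin> E)" if "x \<in> V" for x
      using that by (simp add: sat_diagonal_fm)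
    then have "D_subset V E d u"
      unfolding D_subset_def N_def by blast
    then obtain p w where p: "p \<in> N V E f" and "w \<in> V" and pw: "D_pair V E p w d"
      using surj \<open>d \<in> V\<close> unfolding D_surjection_def by blast
    have fn: "D_function V E f u"
      using surj by (simp add: D_surjection_def)
    \<comment> \<open>Surjectivity only gives \<open>w \<in> V\<close>. The relation clause makes
      \<open>p\<close> a pair whose first component is an element of \<open>u\<close>, and
      injectivity identifies that component with \<open>w\<close>.\<close>
    then have w: "w \<in> N V E u"
      using p D_pair_inject[OF pw] unfolding D_function_def D_relation_def by blast
    have "\<exists>!p. p \<in> N V E f \<and> (\<exists>w'\<in>V. D_pair V E p w w')"
      using fn w by (simp add: D_function_def)
    then obtain p0 where p0: "\<And>q w'. q \<in> N V E f \<Longrightarrow> w' \<in> V \<Longrightarrow> D_pair V E q w w' \<Longrightarrow> q = p0"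
      by (elim ex1E) blast
    \<comment> \<open>The function clause makes the vertex coding the pair unique; injectivity
      carries this over to the second component.\<close>
    have "w' = d" if "q \<in> N V E f" "w' \<in> V" "D_pair V E q w w'" for q w'
    proof -
      have "q = p"
        using p0[OF that] p0[OF p \<open>d \<in> V\<close> pw] by simp
      then have "D_pair V E p w w'"
        using that(3) by simp
      then show ?thesis
        using D_pair_inject[OF pw] by simp
    qed
    \<comment> \<open>The pair \<open>p\<close> with second component \<open>d\<close> is the only
      instance to check, so the defining condition of \<open>d\<close> at \<open>w\<close> negates
      itself.\<close>
    then have "(\<forall>q\<in>V. \<forall>w'\<in>V. (q, f) \<in> E \<and> D_pair V E q w w' \<longrightarrow> (w, w') \<notin> E) \<longleftrightarrow> (w, d) \<notin> E"
      using p pw \<open>d \<in> V\<close> unfolding N_def by blast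
    then show False
      using d[OF \<open>w \<in> V\<close>] w unfolding N_def by blast
  qed
  then show ?thesis
    unfolding cantor_def by blast
qed

end
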